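(* (i) If $f_T(n_0)<\sqrt{n_0}$ for some positive integer $n_0$, then there is a constant $\varepsilon>0$ such that $f_T(n)=O(n^{1/2-\varepsilon})$ as $n\to\infty$. (ii) Likewise, if $f_B(n_0)<\sqrt{n_0}$ for some positive integer $n_0$, then there is a constant $\varepsilon>0$ such that $f_B(n)=O(n^{1/2-\varepsilon})$ as $n\to\infty$.
   Context: All graphs are finite, simple and undirected. For a graph $G$, $t(G)$ denotes the maximum number of vertices of an induced subgraph of $G$ that is a tree (i.e., connected and acyclic). For a positive integer $n$, $f_T(n)=\min\{t(G) : |V(G)|=n,\ G \text{ connected and triangle-free}\}$ and $f_B(n)=\min\{t(G) : |V(G)|=n,\ G \text{ connected and bipartite}\}$. *)

theory Defs
  imports "Graph_Theory.Graph_Theory" "HOL-Library.Landau_Symbols"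
begin

text \<open>
  Finite simple undirected graphs are represented, as usual in \<open>Graph_Theory\<close>, by
  finite loop-free symmetric digraphs (locale \<^locale>\<open>pair_graph\<close>): an edge \<open>uv\<close> is the
  pair of arcs \<open>(u,v)\<close>, \<open>(v,u)\<close>.
  The library's \<^const>\<open>forest\<close> and \<^const>\<open>tree\<close> are not usable in this
  representation, because they count the closed walk \<open>u,v,u\<close> along a single edge as a cycle.
  Cycles of the undirected graph are the directed cycles of length at least 3.
\<close>

definition undirected_forest :: "('a,'b) pre_digraph \<Rightarrow> bool" where
  "undirected_forest G \<longleftrightarrow> \<not> (\<exists>p. pre_digraph.cycle G p \<and> 3 \<le> length p)"

definition undirected_tree :: "('a,'b) pre_digraph \<Rightarrow> bool" where
  "undirected_tree G \<longleftrightarrow> Digraph_Component.connected G \<and> undirected_forest G"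

definition max_induced_tree :: "('a,'b) pre_digraph \<Rightarrow> nat" where
  "max_induced_tree G = Max {card S | S. S \<subseteq> verts G \<and> undirected_tree (G \<restriction> S)}"

text \<open>For a nonempty graph the maximum is taken over a finite nonempty set.\<close>

lemma undirected_tree_singleton:
  assumes "pair_graph G" "v \<in> pverts G"
  shows "undirected_tree (with_proj G \<restriction> {v})"
proof -
  interpret pair_graph G by fact
  have A: "arcs (with_proj G \<restriction> {v}) = {}"
    using no_loops by fastforce
  have "undirected_forest (with_proj G \<restriction> {v})"
    unfolding undirected_forest_def pre_digraph.cycle_def pre_digraph.awalk_def A by auto
  moreover have "Digraph_Component.connected (with_proj G \<restriction> {v})"
    unfolding Digraph_Component.connected_def strongly_connected_def mk_symmetric_def reachable_def
    by auto
  ultimately show ?thesis by (simp add: undirected_tree_def)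
qed

lemma
  assumes "pair_graph G" "pverts G \<noteq> {}"
  shows finite_induced_trees:
      "finite {card S | S. S \<subseteq> verts (with_proj G) \<and> undirected_tree (with_proj G \<restriction> S)}"
    and induced_trees_nonempty:
      "{card S | S. S \<subseteq> verts (with_proj G) \<and> undirected_tree (with_proj G \<restriction> S)} \<noteq> {}"
    and max_induced_tree_le: "max_induced_tree (with_proj G) \<le> card (pverts G)"
proof -
  interpret pair_graph G by fact
  let ?X = "{card S | S. S \<subseteq> verts (with_proj G) \<and> undirected_tree (with_proj G \<restriction> S)}"
  have fin: "finite (pverts G)" by (rule pair_finite_verts)
  have sub: "?X \<subseteq> {..card (pverts G)}" using fin by (auto intro: card_mono)
  then show f: "finite ?X" by (rule finite_subset) simp
  obtain v where "v \<in> pverts G" using assms by auto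
  then have "card {v} \<in> ?X" using undirected_tree_singleton[OF assms(1)] by force
  then show n: "?X \<noteq> {}" by blast
  show "max_induced_tree (with_proj G) \<le> card (pverts G)"
    unfolding max_induced_tree_def using Max_in[OF f n] sub by blast
qed

text \<open>In a loop-free graph the three vertices below are automatically distinct.\<close>

definition triangle_free :: "('a,'b) pre_digraph \<Rightarrow> bool" where
  "triangle_free G \<longleftrightarrow>
     \<not> (\<exists>u v w. u \<rightarrow>\<^bsub>G\<^esub> v \<and> v \<rightarrow>\<^bsub>G\<^esub> w \<and> w \<rightarrow>\<^bsub>G\<^esub> u)"

definition bipartite :: "('a,'b) pre_digraph \<Rightarrow> bool" where
  "bipartite G \<longleftrightarrow>
     (\<exists>U W. verts G = U \<union> W \<and> U \<inter> W = {} \<and> arcs_ends G \<subseteq> U \<times> W \<union> W \<times> U)"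

text \<open>
  Every finite graph is isomorphic to one whose vertices are natural numbers, so the minima
  range over graphs with vertex set a finite set of naturals.
\<close>

definition f_T :: "nat \<Rightarrow> nat" where
  "f_T n = Min {max_induced_tree (with_proj G) | G :: nat pair_pre_digraph.
     pair_graph G \<and> card (pverts G) = n \<and>
     Digraph_Component.connected (with_proj G) \<and> triangle_free (with_proj G)}"

definition f_B :: "nat \<Rightarrow> nat" where
  "f_B n = Min {max_induced_tree (with_proj G) | G :: nat pair_pre_digraph.
     pair_graph G \<and> card (pverts G) = n \<and>
     Digraph_Component.connected (with_proj G) \<and> bipartite (with_proj G)}"

text \<open>For \<open>n > 0\<close> both minima are taken over finite nonempty sets; stars witness nonemptiness.\<close>

definition star_graph :: "nat \<Rightarrow> nat pair_pre_digraph" where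
  "star_graph n = \<lparr> pverts = {..<n}, parcs = {0} \<times> {1..<n} \<union> {1..<n} \<times> {0} \<rparr>"

lemma star_graph: assumes "n > 0"
  shows "pair_graph (star_graph n)" "card (pverts (star_graph n)) = n"
   "Digraph_Component.connected (with_proj (star_graph n))"
   "bipartite (with_proj (star_graph n))" "triangle_free (with_proj (star_graph n))"
proof -
  show "pair_graph (star_graph n)" using assms
    by unfold_locales (auto simp: star_graph_def symmetric_def sym_def)
  show "card (pverts (star_graph n)) = n" by (simp add: star_graph_def)
  show "bipartite (with_proj (star_graph n))" unfolding bipartite_def using assms
    by (intro exI[of _ "{0}"] exI[of _ "{1..<n}"]) (auto simp: star_graph_def)
  show "triangle_free (with_proj (star_graph n))" unfolding triangle_free_def by (auto simp: star_graph_def)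
  let ?H = "with_proj (mk_symmetric (with_proj (star_graph n)))"
  have v: "verts ?H = {..<n}" and a: "arcs_ends ?H = {0} \<times> {1..<n} \<union> {1..<n} \<times> {0}"
    by (auto simp: mk_symmetric_def star_graph_def)
  have "(0,v) \<in> rtrancl_on {..<n} ({0} \<times> {1..<n} \<union> {1..<n} \<times> {0})" if "v < n" for v
    using that assms by (cases "v = 0") (auto intro: rtrancl_on_into_rtrancl_on[OF rtrancl_on_refl])
  moreover have "(v,0) \<in> rtrancl_on {..<n} ({0} \<times> {1..<n} \<union> {1..<n} \<times> {0})" if "v < n" for v
    using that assms by (cases "v = 0") (auto intro: rtrancl_on_into_rtrancl_on[OF rtrancl_on_refl])
  ultimately show "Digraph_Component.connected (with_proj (star_graph n))"
    unfolding Digraph_Component.connected_def strongly_connected_def reachable_def v a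
    using assms by (auto intro: rtrancl_on_trans)
qed

lemma
  assumes "n > 0"
  shows finite_graph_family: "finite {max_induced_tree (with_proj G) | G :: nat pair_pre_digraph.
      pair_graph G \<and> card (pverts G) = n \<and>
      Digraph_Component.connected (with_proj G) \<and> P (with_proj G)}" (is "finite ?X")
    and graph_family_nonempty: "P (with_proj (star_graph n)) \<Longrightarrow>
      {max_induced_tree (with_proj G) | G :: nat pair_pre_digraph.
      pair_graph G \<and> card (pverts G) = n \<and>
      Digraph_Component.connected (with_proj G) \<and> P (with_proj G)} \<noteq> {}"
proof -
  have "?X \<subseteq> {..n}"
    using assms max_induced_tree_le by fastforce
  then show "finite ?X" by (rule finite_subset) simp
  show "?X \<noteq> {}" if "P (with_proj (star_graph n))"
    using star_graph[OF assms] that by blast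
qed

end

theory Submission
  imports Defs "HOL-Analysis.Function_Topology"
begin

text \<open>
  Both hypotheses are never satisfied: every vertex \<open>r\<close> of a connected triangle-free graph on
  \<open>n\<close> vertices lies in an induced tree with at least \<open>1 + \<surd>(n - 1) \<ge> \<surd>n\<close> vertices.
  By induction, each component \<open>C\<close> of the graph without \<open>r\<close> and its neighbours contributes
  \<open>\<surd>|C|\<close> vertices as soon as exactly one of its neighbours next to \<open>r\<close> is put into the tree.
  That the neighbours of \<open>r\<close> can be selected so that the total gain is the square root of the sum
  is a fact about set systems with weights \<open>y\<close>: some set of points hits sets of total weight at
  least \<open>\<parallel>y\<parallel>\<^sub>2\<close> exactly once. Indeed, the maximum \<open>\<mu>\<close> of that total weight bounds
  the value \<open>\<Sum>x\<^sub>b y\<^sub>b\<close> of every fractional packing \<open>x\<close>, and \<open>y / \<mu>\<close> is such a packing,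
  since hitting with a single point has weight at most \<open>\<mu>\<close>.
\<close>

section \<open>Points hitting members of a set system exactly once\<close>

text \<open>Tychonoff's theorem. The coordinates outside \<open>B\<close> are pinned to 0 because
  functions are total: a free coordinate would range over the whole real line and destroy
  compactness.\<close>

lemma compact_box: "compact {x :: 'b \<Rightarrow> real. \<forall>b. x b \<in> (if b \<in> B then {0..1} else {0})}"
proof -
  have "compactin (product_topology (\<lambda>_. euclidean) UNIV)
      (PiE UNIV (\<lambda>b::'b. if b \<in> B then {0..1} else {0::real}))"
    by (subst compactin_PiE) auto
  then show ?thesis
    by (simp add: euclidean_product_topology PiE_UNIV_domain Pi_def)
qed

lemma continuous_on_weighted_sum:
  "continuous_on S (\<lambda>x :: 'b \<Rightarrow> real. \<Sum>b\<in>B. x b * y b)"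
  by (intro continuous_intros continuous_on_subset[OF continuous_on_product_coordinates]) auto

text \<open>A subfamily of least cardinality covering \<open>T\<close> works: a member without a
  private point in \<open>T\<close> could be dropped, leaving a smaller cover.\<close>

lemma exists_minimal_cover:
  assumes "finite F" "T \<subseteq> (\<Union>b\<in>F. N b)"
  shows "\<exists>M p. M \<subseteq> F \<and> T \<subseteq> (\<Union>b\<in>M. N b) \<and>
    (\<forall>b\<in>M. p b \<in> T \<and> p b \<in> N b \<and> (\<forall>b'\<in>M. p b \<in> N b' \<longrightarrow> b' = b))"
proof -
  let ?P = "\<lambda>M. M \<subseteq> F \<and> T \<subseteq> (\<Union>b\<in>M. N b)"
  obtain M where M: "?P M" and min: "\<And>M'. ?P M' \<Longrightarrow> card M \<le> card M'"
    using ex_has_least_nat[of ?P F card] assms by auto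
  have fin: "finite M" using M assms(1) finite_subset by blast
  have "\<forall>b\<in>M. \<exists>a. a \<in> T \<and> a \<in> N b \<and> (\<forall>b'\<in>M. a \<in> N b' \<longrightarrow> b' = b)"
  proof (rule ballI, rule ccontr)
    fix b
    assume b: "b \<in> M"
    assume "\<not> (\<exists>a. a \<in> T \<and> a \<in> N b \<and> (\<forall>b'\<in>M. a \<in> N b' \<longrightarrow> b' = b))"
    then have "?P (M - {b})" using M by blast
    then have "card M \<le> card (M - {b})" by (rule min)
    then show False using fin b by (metis card_Diff1_less not_less)
  qed
  from bchoice[OF this] obtain p
    where "\<forall>b\<in>M. p b \<in> T \<and> p b \<in> N b \<and> (\<forall>b'\<in>M. p b \<in> N b' \<longrightarrow> b' = b)" ..
  with M show ?thesis by (intro exI[of _ M] exI[of _ p] conjI) simp_all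
qed

abbreviation hit_once :: "('b \<Rightarrow> 'a set) \<Rightarrow> 'b set \<Rightarrow> 'a set \<Rightarrow> 'b set" where
  "hit_once N B A \<equiv> {b \<in> B. \<exists>a. N b \<inter> A = {a}}"

text \<open>
  At a packing \<open>x\<close> of maximal value \<open>V\<close>, let \<open>M\<close> be a minimal cover of the tight points
  by sets in the support of \<open>x\<close>. Then \<open>(x - \<epsilon> 1\<^sub>M) / (1 - \<epsilon>)\<close> is a packing for small \<open>\<epsilon>\<close>, so
  maximality gives \<open>V \<le> y(M)\<close>; private points of the members of \<open>M\<close> hit each of them once.
\<close>

lemma fractional_packing_le:
  fixes x y :: "'b \<Rightarrow> real"
  assumes fin: "finite A" "finite B"
    and N: "\<And>b. b \<in> B \<Longrightarrow> N b \<subseteq> A" "\<And>b. b \<in> B \<Longrightarrow> N b \<noteq> {}"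
    and y: "\<And>b. b \<in> B \<Longrightarrow> y b \<ge> 0"
    and \<mu>: "\<And>A'. A' \<subseteq> A \<Longrightarrow> (\<Sum>b\<in>hit_once N B A'. y b) \<le> \<mu>"
    and x: "\<And>b. b \<in> B \<Longrightarrow> x b \<ge> 0" "\<And>a. a \<in> A \<Longrightarrow> (\<Sum>b\<in>{b\<in>B. a \<in> N b}. x b) \<le> 1"
  shows "(\<Sum>b\<in>B. x b * y b) \<le> \<mu>"
proof -
  \<comment> \<open>\<open>L x a\<close> is the load of \<open>x\<close> at the point
    \<open>a\<close>, and \<open>K\<close> is the polytope of fractional packings. The upper bound 1
    in the box cuts nothing off, since \<open>x b\<close> is at most the load at any point of the
    nonempty set \<open>N b\<close>.\<close>
  define L where "L = (\<lambda>(x::'b\<Rightarrow>real) a. \<Sum>b\<in>{b\<in>B. a \<in> N b}. x b)"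
  define K where "K = {x::'b\<Rightarrow>real. \<forall>b. x b \<in> (if b \<in> B then {0..1} else {0})} \<inter> (\<Inter>a\<in>A. {x. L x a \<le> 1})"
  have le1: "z b \<le> 1" if "\<And>b. b \<in> B \<Longrightarrow> z b \<ge> 0" "\<And>a. a \<in> A \<Longrightarrow> L z a \<le> 1" and b: "b \<in> B" for z b
  proof -
    obtain a where a: "a \<in> N b" "a \<in> A" using N b by blast
    have "z b \<le> L z a" unfolding L_def using that a fin by (intro member_le_sum) auto
    then show ?thesis using that(2)[OF a(2)] by simp
  qed
  have KI: "(\<lambda>b. if b \<in> B then z b else 0) \<in> K"
    if "\<And>b. b \<in> B \<Longrightarrow> z b \<ge> 0" "\<And>a. a \<in> A \<Longrightarrow> L z a \<le> 1" for z
  proof -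
    have "L (\<lambda>b. if b \<in> B then z b else 0) a = L z a" for a
      unfolding L_def by (rule sum.cong) auto
    then show ?thesis using that le1[of z] by (auto simp: K_def)
  qed
  have "closed {x. L x a \<le> 1}" for a
    unfolding L_def using continuous_on_weighted_sum[of UNIV "\<lambda>_. 1" "{b\<in>B. a \<in> N b}"]
    by (intro closed_Collect_le continuous_intros) simp_all
  then have "compact K" unfolding K_def
    by (intro compact_Int_closed compact_box closed_INT) auto
  moreover have xK: "(\<lambda>b. if b \<in> B then x b else 0) \<in> K" using KI[of x] x by (simp add: L_def)
  ultimately obtain z where z: "z \<in> K"
    and zmax: "\<And>w. w \<in> K \<Longrightarrow> (\<Sum>b\<in>B. w b * y b) \<le> (\<Sum>b\<in>B. z b * y b)"
    using continuous_attains_sup[of K, OF _ _ continuous_on_weighted_sum[of K y B]] by blast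
  define V where "V = (\<Sum>b\<in>B. z b * y b)"
  have z0: "z b \<ge> 0" if "b \<in> B" for b using z that unfolding K_def by (auto split: if_splits dest: spec[of _ b])
  have z1: "L z a \<le> 1" if "a \<in> A" for a using z that by (auto simp: K_def)
  define T where "T = {a\<in>A. L z a = 1}"
  have "\<exists>b\<in>{b\<in>B. z b > 0}. a \<in> N b" if "a \<in> T" for a
  proof (rule ccontr)
    assume "\<not> ?thesis"
    then have "L z a = 0" unfolding L_def using z0 by (intro sum.neutral) force
    then show False using that by (simp add: T_def)
  qed
  then have cover: "T \<subseteq> (\<Union>b\<in>{b\<in>B. z b > 0}. N b)" by blast
  have "finite {b\<in>B. z b > 0}" using fin by simp
  from exists_minimal_cover[OF this cover] obtain M p where M: "M \<subseteq> {b\<in>B. z b > 0}" "T \<subseteq> (\<Union>b\<in>M. N b)"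
    and p: "\<forall>b\<in>M. p b \<in> T \<and> p b \<in> N b \<and> (\<forall>b'\<in>M. p b \<in> N b' \<longrightarrow> b' = b)"
    by (elim exE conjE)
  have finM: "finite M" using M(1) fin(2) by (auto intro: finite_subset)
  have "M \<subseteq> hit_once N B (p ` M)"
  proof
    fix b
    assume b: "b \<in> M"
    then have "N b \<inter> p ` M = {p b}" using p by blast
    then show "b \<in> hit_once N B (p ` M)" using b M(1) by blast
  qed
  then have "(\<Sum>b\<in>M. y b) \<le> (\<Sum>b\<in>hit_once N B (p ` M). y b)"
    using fin y by (intro sum_mono2) auto
  also have "\<dots> \<le> \<mu>" using p T_def by (intro \<mu>) auto
  finally have yM: "(\<Sum>b\<in>M. y b) \<le> \<mu>" .
  \<comment> \<open>The bound \<open>1/2\<close> keeps \<open>1 - \<epsilon>\<close> positive, the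
    values of \<open>z\<close> on \<open>M\<close> keep \<open>w\<close> nonnegative, and the slacks
    at the points outside \<open>T\<close> keep the loads there at most
    \<open>1 - \<epsilon>\<close> before rescaling.\<close>
  define Q where "Q = {1/2} \<union> z ` M \<union> (\<lambda>a. 1 - L z a) ` (A - T)"
  define \<epsilon> where "\<epsilon> = Min Q"
  have "finite Q" "Q \<noteq> {}" unfolding Q_def using finM fin by auto
  moreover have "q > 0" if "q \<in> Q" for q using that M(1) z1 by (force simp: Q_def T_def less_le)
  ultimately have e0: "\<epsilon> > 0" and eQ: "\<And>q. q \<in> Q \<Longrightarrow> \<epsilon> \<le> q"
    unfolding \<epsilon>_def by auto
  have e1: "\<epsilon> < 1" using eQ[of "1/2"] by (simp add: Q_def)
  define w where "w = (\<lambda>b. (z b - (if b \<in> M then \<epsilon> else 0)) / (1 - \<epsilon>))"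
  have w0: "w b \<ge> 0" if "b \<in> B" for b
    using z0[OF that] eQ[of "z b"] e1 by (auto simp: w_def Q_def)
  have "L w a \<le> 1" if a: "a \<in> A" for a
  proof -
    have "L w a = (L z a - (\<Sum>b\<in>{b\<in>B. a \<in> N b}. if b \<in> M then \<epsilon> else 0)) / (1 - \<epsilon>)"
      unfolding L_def w_def by (simp add: sum_subtractf flip: sum_divide_distrib)
    \<comment> \<open>A tight point lies in some member of \<open>M\<close>, so its load drops by at
      least \<epsilon>; any other point already has slack at least \<epsilon>.\<close>
    moreover have "L z a - (\<Sum>b\<in>{b\<in>B. a \<in> N b}. if b \<in> M then \<epsilon> else 0) \<le> 1 - \<epsilon>"
    proof (cases "a \<in> T")
      case True
      then obtain b where b: "b \<in> M" "a \<in> N b" using M(2) by blast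
      have "(if b \<in> M then \<epsilon> else 0) \<le> (\<Sum>b\<in>{b\<in>B. a \<in> N b}. if b \<in> M then \<epsilon> else 0)"
        using b M(1) fin e0 by (intro member_le_sum) auto
      then show ?thesis using b z1[OF a] by simp
    next
      case False
      have "(\<Sum>b\<in>{b\<in>B. a \<in> N b}. if b \<in> M then \<epsilon> else 0) \<ge> 0" using e0 by (intro sum_nonneg) auto
      then show ?thesis using eQ[of "1 - L z a"] False a by (simp add: Q_def)
    qed
    ultimately show ?thesis using e1 by simp
  qed
  from zmax[OF KI[of w, OF w0 this]]
  have "(\<Sum>b\<in>B. w b * y b) \<le> V" by (simp add: V_def)
  moreover have "(\<Sum>b\<in>B. w b * y b) = (V - \<epsilon> * (\<Sum>b\<in>M. y b)) / (1 - \<epsilon>)"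
  proof -
    have "(\<Sum>b\<in>B. w b * y b) = (\<Sum>b\<in>B. z b * y b - (if b \<in> M then \<epsilon> * y b else 0)) / (1 - \<epsilon>)"
      unfolding w_def sum_divide_distrib by (rule sum.cong) (auto simp: algebra_simps)
    also have "\<dots> = (V - (\<Sum>b\<in>B. if b \<in> M then \<epsilon> * y b else 0)) / (1 - \<epsilon>)"
      by (simp add: sum_subtractf V_def)
    also have "(\<Sum>b\<in>B. if b \<in> M then \<epsilon> * y b else 0) = \<epsilon> * (\<Sum>b\<in>M. y b)"
      using fin M(1) by (subst sum.inter_restrict[symmetric]) (auto simp: sum_distrib_left intro!: sum.cong)
    finally show ?thesis .
  qed
  \<comment> \<open>Optimality of \<open>V\<close> against the competitor \<open>w\<close>, with the
    denominator cleared; once \<open>V\<close> cancels, only the terms with factor \<epsilon>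
    remain.\<close>
  ultimately have "V - \<epsilon> * (\<Sum>b\<in>M. y b) \<le> V * (1 - \<epsilon>)" using e1 by (simp add: pos_divide_le_eq)
  then have "\<epsilon> * V \<le> \<epsilon> * (\<Sum>b\<in>M. y b)" by (simp add: algebra_simps)
  then have "V \<le> \<mu>" using e0 yM by simp
  moreover have "(\<Sum>b\<in>B. x b * y b) \<le> V"
    using zmax[OF xK] by (simp add: V_def)
  ultimately show ?thesis by simp
qed

lemma exists_hit_once_ge_l2_norm:
  fixes y :: "'b \<Rightarrow> real"
  assumes fin: "finite A" "finite B"
    and N: "\<And>b. b \<in> B \<Longrightarrow> N b \<subseteq> A" "\<And>b. b \<in> B \<Longrightarrow> N b \<noteq> {}"
    and y: "\<And>b. b \<in> B \<Longrightarrow> y b \<ge> 0"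
  shows "\<exists>A'\<subseteq>A. sqrt (\<Sum>b\<in>B. (y b)\<^sup>2) \<le> (\<Sum>b\<in>hit_once N B A'. y b)"
proof -
  define h where "h A' = (\<Sum>b\<in>hit_once N B A'. y b)" for A'
  have finh: "finite (h ` Pow A)" "h ` Pow A \<noteq> {}" using fin by auto
  define \<mu> where "\<mu> = Max (h ` Pow A)"
  have "\<mu> \<in> h ` Pow A" unfolding \<mu>_def using finh by (rule Max_in)
  then obtain A' where A': "A' \<subseteq> A" "h A' = \<mu>" by auto
  have ub: "h X \<le> \<mu>" if "X \<subseteq> A" for X unfolding \<mu>_def using finh that by auto
  have \<mu>0: "\<mu> \<ge> 0" using ub[of "{}"] by (simp add: h_def)
  have load: "(\<Sum>b\<in>{b\<in>B. a \<in> N b}. y b) \<le> \<mu>" if "a \<in> A" for a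
  proof -
    have "(\<exists>a'. N b \<inter> {a} = {a'}) \<longleftrightarrow> a \<in> N b" for b
      by (cases "a \<in> N b") simp_all
    then have "hit_once N B {a} = {b\<in>B. a \<in> N b}" by simp
    then show ?thesis using ub[of "{a}"] that by (simp add: h_def)
  qed
  have "(\<Sum>b\<in>B. (y b)\<^sup>2) \<le> \<mu>\<^sup>2"
  \<comment> \<open>Scaling \<open>y\<close> by \<open>1 / \<mu>\<close> needs \<mu> > 0. For \<mu>
    = 0 every \<open>y b\<close> vanishes, being bounded by the load at any point of
    \<open>N b\<close>.\<close>
  proof (cases "\<mu> = 0")
    case True
    have "y b = 0" if b: "b \<in> B" for b
    proof -
      obtain a where a: "a \<in> N b" "a \<in> A" using N b by blast
      have "y b \<le> (\<Sum>b\<in>{b\<in>B. a \<in> N b}. y b)" using a b y fin by (intro member_le_sum) auto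
      then show ?thesis using load[OF a(2)] y[OF b] True by simp
    qed
    then show ?thesis using True by simp
  next
    case False
    then have pos: "\<mu> > 0" using \<mu>0 by simp
    have "(\<Sum>b\<in>B. (y b / \<mu>) * y b) \<le> \<mu>"
    proof (rule fractional_packing_le[OF fin N y])
      show "(\<Sum>b\<in>hit_once N B X. y b) \<le> \<mu>" if "X \<subseteq> A" for X using ub[OF that] by (simp add: h_def)
      show "(\<Sum>b\<in>{b\<in>B. a \<in> N b}. y b / \<mu>) \<le> 1" if "a \<in> A" for a
        using load[OF that] pos by (simp flip: sum_divide_distrib)
    qed (use y pos in auto)
    then have "(\<Sum>b\<in>B. y b * y b) / \<mu> \<le> \<mu>" by (simp add: sum_divide_distrib)
    then show ?thesis using pos by (simp add: power2_eq_square pos_divide_le_eq)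
  qed
  then show ?thesis using A' \<mu>0 real_le_lsqrt unfolding h_def by blast
qed

section \<open>Trees grown by attaching leaves\<close>

text \<open>Induced trees containing \<open>r\<close>, encoded by a construction order in which each
  new vertex has exactly one neighbour among the earlier ones. Only arcs into the new vertex are
  inspected, which for symmetric \<open>E\<close> covers all adjacencies. Gluing and acyclicity
  become inductions on the order of attachment.\<close>

inductive leaf_tree :: "'a rel \<Rightarrow> 'a \<Rightarrow> 'a set \<Rightarrow> bool" for E r where
  root: "leaf_tree E r {r}"
| leaf: "leaf_tree E r T \<Longrightarrow> u \<notin> T \<Longrightarrow> w \<in> T \<Longrightarrow> (w,u) \<in> E \<Longrightarrow>
    (\<And>w'. w' \<in> T \<Longrightarrow> (w',u) \<in> E \<Longrightarrow> w' = w) \<Longrightarrow> leaf_tree E r (insert u T)"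

lemma leaf_tree_root: "leaf_tree E r T \<Longrightarrow> r \<in> T"
  by (induction rule: leaf_tree.induct) auto

lemma leaf_tree_finite: "leaf_tree E r T \<Longrightarrow> finite T"
  by (induction rule: leaf_tree.induct) auto

text \<open>The leaves of \<open>S\<close> are attached to \<open>T\<close> in their original order.
  The only vertex of \<open>T\<close> they may see is \<open>a\<close>, the root of
  \<open>S\<close>, so each keeps its old parent as unique neighbour.\<close>

lemma leaf_tree_glue:
  assumes "leaf_tree E a S" "leaf_tree E r T" "a \<in> T" "(S - {a}) \<inter> T = {}"
    "\<And>x y. x \<in> S - {a} \<Longrightarrow> y \<in> T - {a} \<Longrightarrow> (y,x) \<notin> E"
  shows "leaf_tree E r (T \<union> S)"
  using assms
proof (induction rule: leaf_tree.induct)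
  case root
  then show ?case by (simp add: insert_absorb)
next
  case (leaf S u w)
  have a: "a \<in> S" using leaf.hyps(1) by (rule leaf_tree_root)
  have ua: "u \<noteq> a" using a leaf.hyps(2) by blast
  have "leaf_tree E r (T \<union> S)"
    by (rule leaf.IH) (use leaf.prems in auto)
  then have "leaf_tree E r (insert u (T \<union> S))"
  proof (rule leaf_tree.leaf)
    show "u \<notin> T \<union> S" using leaf.hyps(2) leaf.prems(3) ua by blast
    show "w \<in> T \<union> S" "(w,u) \<in> E" using leaf.hyps(3,4) by auto
    show "w' = w" if "w' \<in> T \<union> S" "(w',u) \<in> E" for w'
    proof (cases "w' \<in> S")
      case True
      then show ?thesis using leaf.hyps(5) that(2) by blast
    next
      case False
      then show ?thesis using leaf.prems(4)[of u w'] that a ua by blast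
    qed
  qed
  then show ?case by simp
qed

lemma leaf_tree_star:
  assumes "finite A" "r \<notin> A" "\<And>a. a \<in> A \<Longrightarrow> (r,a) \<in> E" "\<And>a b. a \<in> A \<Longrightarrow> b \<in> A \<Longrightarrow> (a,b) \<notin> E"
  shows "leaf_tree E r (insert r A)"
  using assms
proof (induction A rule: finite_induct)
  case empty
  then show ?case by (simp add: leaf_tree.root)
next
  case (insert u A)
  have "leaf_tree E r (insert u (insert r A))"
  proof (rule leaf_tree.leaf)
    show "leaf_tree E r (insert r A)" using insert by blast
    show "r \<in> insert r A" by simp
  qed (use insert in auto)
  then show ?case by (simp add: insert_commute)
qed

text \<open>Iterated gluing. Several \<open>S i\<close> may hang at the same vertex of
  \<open>T\<close>, so disjointness and non-adjacency concern these sets without their roots. Each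
  root is already counted in \<open>T\<close>, hence the gain \<open>card (S i) - 1\<close>.\<close>

lemma leaf_tree_glue_family:
  assumes "finite I" "leaf_tree E r T"
    "\<And>i. i \<in> I \<Longrightarrow> a i \<in> T" "\<And>i. i \<in> I \<Longrightarrow> leaf_tree E (a i) (S i)"
    "\<And>i. i \<in> I \<Longrightarrow> (S i - {a i}) \<inter> T = {}"
    "\<And>i x y. i \<in> I \<Longrightarrow> x \<in> S i - {a i} \<Longrightarrow> y \<in> T - {a i} \<Longrightarrow> (y,x) \<notin> E"
    "\<And>i j. i \<in> I \<Longrightarrow> j \<in> I \<Longrightarrow> i \<noteq> j \<Longrightarrow> (S i - {a i}) \<inter> (S j - {a j}) = {}"
    "\<And>i j x y. i \<in> I \<Longrightarrow> j \<in> I \<Longrightarrow> i \<noteq> j \<Longrightarrow> x \<in> S i - {a i} \<Longrightarrow> y \<in> S j - {a j} \<Longrightarrow> (y,x) \<notin> E"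
  shows "leaf_tree E r (T \<union> (\<Union>i\<in>I. S i)) \<and>
    card (T \<union> (\<Union>i\<in>I. S i)) = card T + (\<Sum>i\<in>I. card (S i) - 1)"
  using assms
proof (induction I rule: finite_induct)
  case empty
  then show ?case by simp
next
  case (insert i I)
  let ?U = "T \<union> (\<Union>i\<in>I. S i)"
  have "leaf_tree E r ?U \<and> card ?U = card T + (\<Sum>i\<in>I. card (S i) - 1)"
  proof (rule insert.IH)
    show "(y,x) \<notin> E" if "j \<in> I" "x \<in> S j - {a j}" "y \<in> T - {a j}" for j x y
      using insert.prems(5)[of j x y] that by blast
    show "(y,x) \<notin> E" if "j \<in> I" "k \<in> I" "j \<noteq> k" "x \<in> S j - {a j}" "y \<in> S k - {a k}" for j k x y
      using insert.prems(7)[of j k x y] that by blast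
  qed (use insert.prems(1-4,6) in auto)
  then have IH: "leaf_tree E r ?U" "card ?U = card T + (\<Sum>i\<in>I. card (S i) - 1)"
    by blast+
  have Ui: "y \<in> T \<or> (\<exists>j\<in>I. y \<in> S j - {a j})" if "y \<in> ?U" for y
    using that insert.prems(2)[of _] by blast
  have disj: "(S i - {a i}) \<inter> ?U = {}"
  proof -
    have "x \<notin> S i - {a i}" if "x \<in> ?U" for x
      using Ui[OF that]
    proof
      assume "x \<in> T"
      then show ?thesis using insert.prems(4)[of i] by blast
    next
      assume "\<exists>j\<in>I. x \<in> S j - {a j}"
      then obtain j where "j \<in> I" "x \<in> S j - {a j}" by blast
      then show ?thesis using insert.prems(6)[of i j] insert.hyps(2) by blast
    qed
    then show ?thesis by blast
  qed
  have nE: "(y,x) \<notin> E" if "x \<in> S i - {a i}" "y \<in> ?U - {a i}" for x y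
  proof -
    have "y \<in> T \<or> (\<exists>j\<in>I. y \<in> S j - {a j})" using Ui that(2) by blast
    then show ?thesis
    proof
      assume "y \<in> T"
      then show ?thesis using insert.prems(5)[of i x y] that by blast
    next
      assume "\<exists>j\<in>I. y \<in> S j - {a j}"
      then obtain j where "j \<in> I" "y \<in> S j - {a j}" by blast
      then show ?thesis using insert.prems(7)[of i j x y] insert.hyps(2) that by blast
    qed
  qed
  have ai: "a i \<in> T" and Si: "leaf_tree E (a i) (S i)" using insert.prems by auto
  have "leaf_tree E r (?U \<union> S i)"
    using Si IH(1) _ disj nE by (rule leaf_tree_glue) (use ai in auto)
  moreover have "?U \<union> S i = T \<union> (\<Union>i\<in>insert i I. S i)" by auto
  moreover have "card (?U \<union> S i) = card ?U + (card (S i) - 1)"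
  proof -
    have "?U \<union> S i = ?U \<union> (S i - {a i})" using ai by blast
    moreover have "card (?U \<union> (S i - {a i})) = card ?U + card (S i - {a i})"
      using leaf_tree_finite[OF IH(1)] leaf_tree_finite[OF Si] disj
      by (intro card_Un_disjoint) auto
    moreover have "card (S i - {a i}) = card (S i) - 1"
      using leaf_tree_root[OF Si] by simp
    ultimately show ?thesis by simp
  qed
  ultimately show ?case using IH(2) insert.hyps by simp
qed

section \<open>Connected triangle-free graphs\<close>

text \<open>Every vertex along a walk from \<open>u\<close> is itself reachable from
  \<open>u\<close>, so the walk never leaves the component. Thus a component is connected as a graph
  of its own, as the induction on components requires.\<close>

lemma rtrancl_on_component:
  assumes "(u,v) \<in> rtrancl_on W E"
  shows "(u,v) \<in> rtrancl_on {x. (u,x) \<in> rtrancl_on W E} E"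
  using assms
proof (induction rule: rtrancl_on_induct)
  case base
  then show ?case by simp
next
  case (step x y)
  then show ?case by (auto intro: rtrancl_on_into_rtrancl_on)
qed

text \<open>
  Let \<open>A\<close> be the neighbourhood of \<open>r\<close>. Every component \<open>C\<close> of the rest has a neighbour in \<open>A\<close>,
  and a choice \<open>A' \<subseteq> A\<close> yields the tree formed by the star \<open>{r} \<union> A'\<close> and, for each \<open>C\<close> with
  exactly one neighbour \<open>a \<in> A'\<close>, the inductively given tree in \<open>{a} \<union> C\<close> rooted at \<open>a\<close>.
  With weights \<open>1\<close> for the points of \<open>A\<close> and \<open>\<surd>|C|\<close> for the components, the squared weights
  add up to \<open>|V| - 1\<close>.
\<close>

lemma exists_large_leaf_tree:
  fixes E :: "'a rel"
  assumes "finite V" "sym E"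
    and tri: "\<And>x y z. (x,y) \<in> E \<Longrightarrow> (y,z) \<in> E \<Longrightarrow> (z,x) \<notin> E"
    and "r \<in> V" "\<And>u. u \<in> V \<Longrightarrow> (r,u) \<in> rtrancl_on V E"
  shows "\<exists>S\<subseteq>V. leaf_tree E r S \<and> sqrt (real (card V - 1)) \<le> real (card S - 1)"
  using assms(1,4,5)
proof (induction V arbitrary: r rule: finite_psubset_induct)
  case (psubset V)
  note conn = psubset.prems(2)
  have irr: "(x,x) \<notin> E" for x using tri[of x x x] by blast
  have sy: "(x,y) \<in> E \<longleftrightarrow> (y,x) \<in> E" for x y using \<open>sym E\<close> by (auto dest: symD)
  define A where "A = {a\<in>V. (r,a) \<in> E}"
  define W where "W = V - insert r A"
  define R where "R = rtrancl_on W E"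
  define comp where "comp w = {u. (w,u) \<in> R}" for w
  define \<C> where "\<C> = comp ` W"
  have finA: "finite A" and finW: "finite W" using psubset.hyps by (auto simp: A_def W_def)
  have rA: "r \<notin> A" "r \<notin> W" using irr by (auto simp: A_def W_def)
  have V: "V = insert r (A \<union> W)" "A \<inter> W = {}" using psubset.prems(1) by (auto simp: A_def W_def)
  have RW: "u \<in> W \<and> w \<in> W" if "(u,w) \<in> R" for u w
    using that in_rtrancl_on_in_F unfolding R_def by metis
  have Rsym: "(w,u) \<in> R" if "(u,w) \<in> R" for u w
    using that rtrancl_on_sym[OF \<open>sym E\<close>, of W] unfolding R_def by (auto dest: symD)
  have Rtr: "(u,x) \<in> R" if "(u,w) \<in> R" "(w,x) \<in> R" for u w x
    using that unfolding R_def by (rule rtrancl_on_trans)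
  have comp_eq: "comp c = comp w" if "(w,c) \<in> R" for w c
    using that Rsym Rtr unfolding comp_def by blast
  have self: "w \<in> comp w" if "w \<in> W" for w using that by (simp add: comp_def R_def)
  have \<C>W: "C \<subseteq> W" if "C \<in> \<C>" for C using that RW by (auto simp: \<C>_def comp_def)
  have \<C>comp: "C = comp c" if "C \<in> \<C>" "c \<in> C" for C c
    using that comp_eq by (auto simp: \<C>_def comp_def)
  have \<C>disj: "C \<inter> D = {}" if "C \<in> \<C>" "D \<in> \<C>" "C \<noteq> D" for C D
    using that \<C>comp by blast
  have \<C>edge: "(y,x) \<notin> E" if "C \<in> \<C>" "D \<in> \<C>" "C \<noteq> D" "x \<in> C" "y \<in> D" for C D x y
  proof
    assume "(y,x) \<in> E"
    then have "(y,x) \<in> R"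
      using that \<C>W unfolding R_def by (intro rtrancl_on_into_rtrancl_on[OF rtrancl_on_refl]) auto
    then show False using comp_eq \<C>comp that by metis
  qed
  have finC: "finite \<C>" "\<And>C. C \<in> \<C> \<Longrightarrow> finite C"
    using finW \<C>W by (auto simp: \<C>_def intro: finite_subset)
  \<comment> \<open>A walk from \<open>r\<close> into \<open>W\<close> must pass through
    \<open>A\<close>, since \<open>r\<close> has no neighbour in \<open>W\<close>; the arc from
    \<open>a\<close> to \<open>c\<close> is the one by which the walk last enters
    \<open>W\<close>.\<close>
  have entry: "u \<in> W \<longrightarrow> (\<exists>a\<in>A. \<exists>c\<in>W. (a,c) \<in> E \<and> (c,u) \<in> R)" if "(r,u) \<in> rtrancl_on V E" for u
    using that
  proof (induction rule: rtrancl_on_induct)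
    case base
    then show ?case using rA by simp
  next
    case (step y z)
    show ?case
    proof
      assume z: "z \<in> W"
      then have "y \<noteq> r" using step by (auto simp: W_def A_def)
      then consider "y \<in> A" | "y \<in> W" using V step by blast
      then show "\<exists>a\<in>A. \<exists>c\<in>W. (a,c) \<in> E \<and> (c,z) \<in> R"
      proof cases
        case 1
        then show ?thesis using step z unfolding R_def by blast
      next
        case 2
        then show ?thesis using step z unfolding R_def by (blast intro: rtrancl_on_into_rtrancl_on)
      qed
    qed
  qed
  have nbr: "\<exists>a\<in>A. \<exists>c\<in>C. (a,c) \<in> E" if C: "C \<in> \<C>" for C
  proof -
    obtain w where w: "w \<in> W" "C = comp w" using C by (auto simp: \<C>_def)
    then obtain a c where "a \<in> A" "(a,c) \<in> E" "(c,w) \<in> R"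
      using entry[OF conn[of w]] V(1) by blast
    then show ?thesis using w Rsym by (auto simp: comp_def)
  qed
  \<comment> \<open>The induction hypothesis for \<open>insert a C\<close> with the new root
    \<open>a\<close>: this set is strictly smaller than \<open>V\<close> because \<open>r\<close> is
    missing, and discounting the root leaves exactly \<open>card C\<close> under the square
    root.\<close>
  have sub: "\<exists>S\<subseteq>insert a C. leaf_tree E a S \<and> sqrt (real (card C)) \<le> real (card S - 1)"
    if C: "C \<in> \<C>" and a: "a \<in> A" and c: "c \<in> C" "(a,c) \<in> E" for a c C
  proof -
    have aC: "a \<notin> C" using a \<C>W[OF C] V(2) by blast
    have "insert a C \<subseteq> V" using \<C>W[OF C] a by (auto simp: A_def W_def)
    moreover have "r \<notin> insert a C" using \<C>W[OF C] a rA by auto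
    ultimately have "insert a C \<subset> V" using psubset.prems(1) by blast
    moreover have "(a,u) \<in> rtrancl_on (insert a C) E" if "u \<in> insert a C" for u
    proof (cases "u = a")
      case False
      then have "(c,u) \<in> R" using that \<C>comp[OF C c(1)] by (auto simp: comp_def)
      then have "(c,u) \<in> rtrancl_on C E"
        using rtrancl_on_component[of c u W E] \<C>comp[OF C c(1)] by (simp add: R_def comp_def)
      then have "(c,u) \<in> rtrancl_on (insert a C) E"
        by (rule rtrancl_on_mono[rotated 2]) auto
      then show ?thesis using c by (blast intro: converse_rtrancl_on_into_rtrancl_on)
    qed simp
    ultimately have "\<exists>S\<subseteq>insert a C. leaf_tree E a S
        \<and> sqrt (real (card (insert a C) - 1)) \<le> real (card S - 1)"
      by (intro psubset.IH) auto
    then show ?thesis using aC finC(2)[OF C] by simp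
  qed
  \<comment> \<open>A point \<open>a\<close> of \<open>A\<close> enters the set system as a
    singleton of weight 1, hit once exactly if \<open>a\<close> is selected; a component enters as
    the set of its neighbours in \<open>A\<close>. So the weight hit once accounts for the leaves of
    the star as well as the guaranteed gains from components.\<close>
  define B where "B = Inl ` A \<union> Inr ` \<C>"
  define N where "N = case_sum (\<lambda>a. {a}) (\<lambda>C. {a\<in>A. \<exists>c\<in>C. (a,c) \<in> E})"
  define y where "y = case_sum (\<lambda>_::'a. 1) (\<lambda>C::'a set. sqrt (real (card C)))"
  have "\<exists>A'\<subseteq>A. sqrt (\<Sum>b\<in>B. (y b)\<^sup>2) \<le> (\<Sum>b\<in>hit_once N B A'. y b)"
  proof (rule exists_hit_once_ge_l2_norm)
    show "N b \<noteq> {}" if "b \<in> B" for b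
    proof (cases b)
      case (Inr C)
      then show ?thesis using that nbr[of C] by (auto simp: B_def N_def)
    qed (simp add: N_def)
  qed (use finA finC in \<open>auto simp: B_def N_def y_def\<close>)
  then obtain A' where A': "A' \<subseteq> A" "sqrt (\<Sum>b\<in>B. (y b)\<^sup>2) \<le> (\<Sum>b\<in>hit_once N B A'. y b)" by blast
  define \<D> where "\<D> = {C\<in>\<C>. \<exists>a. N (Inr C) \<inter> A' = {a}}"
  have split: "sum f (Inl ` X \<union> Inr ` Y) = (\<Sum>a\<in>X. f (Inl a)) + (\<Sum>C\<in>Y. f (Inr C))"
    if "finite X" "finite Y" for f :: "'a + 'a set \<Rightarrow> real" and X Y
    using that by (subst sum.union_disjoint) (auto simp: sum.reindex)
  have finD: "finite \<D>" "finite A'" using finC A' finA by (auto simp: \<D>_def intro: finite_subset)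
  have "(\<Sum>b\<in>B. (y b)\<^sup>2) = real (card A) + (\<Sum>C\<in>\<C>. real (card C))"
    unfolding B_def using finA finC by (subst split) (auto simp: y_def)
  also have "(\<Sum>C\<in>\<C>. real (card C)) = real (card W)"
  proof -
    have "\<Union>\<C> = W" using \<C>W self by (auto simp: \<C>_def)
    moreover have "card (\<Union>\<C>) = (\<Sum>C\<in>\<C>. card C)"
      using finC \<C>disj by (intro card_Union_disjoint) (auto simp: pairwise_def disjnt_def)
    ultimately show ?thesis by simp
  qed
  also have "real (card A) + real (card W) = real (card V - 1)"
    using V rA finA finW by (simp add: card_Un_disjoint)
  finally have total: "(\<Sum>b\<in>B. (y b)\<^sup>2) = real (card V - 1)" .
  have "hit_once N B A' = Inl ` A' \<union> Inr ` \<D>"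
  proof (intro set_eqI)
    fix b
    have "Inl x \<in> hit_once N B A' \<longleftrightarrow> Inl x \<in> Inl ` A' \<union> Inr ` \<D>" for x
      using A'(1) by (cases "x \<in> A'") (auto simp: B_def N_def)
    moreover have "Inr C \<in> hit_once N B A' \<longleftrightarrow> Inr C \<in> Inl ` A' \<union> Inr ` \<D>" for C
      by (auto simp: B_def \<D>_def)
    ultimately show "b \<in> hit_once N B A' \<longleftrightarrow> b \<in> Inl ` A' \<union> Inr ` \<D>"
      by (cases b) (simp_all only:)
  qed
  then have hit: "(\<Sum>b\<in>hit_once N B A'. y b) = real (card A') + (\<Sum>C\<in>\<D>. sqrt (real (card C)))"
    using split finD by (simp add: y_def)
  have "\<exists>a S. a \<in> A' \<and> N (Inr C) \<inter> A' = {a} \<and> S \<subseteq> insert a C \<and> leaf_tree E a S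
      \<and> sqrt (real (card C)) \<le> real (card S - 1)" if C: "C \<in> \<D>" for C
  proof -
    obtain a where a: "N (Inr C) \<inter> A' = {a}" using C by (auto simp: \<D>_def)
    then have "a \<in> A'" "a \<in> N (Inr C)" by auto
    moreover then obtain c where "c \<in> C" "(a,c) \<in> E" by (auto simp: N_def)
    ultimately show ?thesis using sub[of C a c] a C A'(1) by (auto simp: \<D>_def)
  qed
  then have "\<forall>C\<in>\<D>. \<exists>P. fst P \<in> A' \<and> N (Inr C) \<inter> A' = {fst P} \<and> snd P \<subseteq> insert (fst P) C
      \<and> leaf_tree E (fst P) (snd P) \<and> sqrt (real (card C)) \<le> real (card (snd P) - 1)"
    by simp
  from bchoice[OF this] obtain P where P: "\<forall>C\<in>\<D>. fst (P C) \<in> A' \<and> N (Inr C) \<inter> A' = {fst (P C)}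
      \<and> snd (P C) \<subseteq> insert (fst (P C)) C \<and> leaf_tree E (fst (P C)) (snd (P C))
      \<and> sqrt (real (card C)) \<le> real (card (snd (P C)) - 1)" ..
  define a S where "a = fst \<circ> P" and "S = snd \<circ> P"
  have aS: "\<And>C. C \<in> \<D> \<Longrightarrow> a C \<in> A' \<and> N (Inr C) \<inter> A' = {a C} \<and> S C \<subseteq> insert (a C) C
      \<and> leaf_tree E (a C) (S C) \<and> sqrt (real (card C)) \<le> real (card (S C) - 1)"
    using P by (simp add: a_def S_def)
  have \<D>\<C>: "C \<in> \<C>" if "C \<in> \<D>" for C using that by (simp add: \<D>_def)
  have SC: "x \<in> C" if "C \<in> \<D>" "x \<in> S C - {a C}" for C x using aS[OF that(1)] that(2) by blast
  let ?T = "insert r A'"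
  have T: "leaf_tree E r ?T"
  proof (rule leaf_tree_star)
    \<comment> \<open>An edge between two neighbours of \<open>r\<close> would close a
      triangle.\<close>
    show "(a,b) \<notin> E" if "a \<in> A'" "b \<in> A'" for a b
      using tri[of r a b] that A'(1) sy[of b r] by (auto simp: A_def)
  qed (use finD A' rA in \<open>auto simp: A_def\<close>)
  have glue: "leaf_tree E r (?T \<union> (\<Union>C\<in>\<D>. S C)) \<and>
    card (?T \<union> (\<Union>C\<in>\<D>. S C)) = card ?T + (\<Sum>C\<in>\<D>. card (S C) - 1)"
  proof (rule leaf_tree_glue_family[OF finD(1) T])
    show "(S C - {a C}) \<inter> ?T = {}" if "C \<in> \<D>" for C
      using SC[OF that] \<C>W[OF \<D>\<C>[OF that]] A'(1) V rA by blast
    show "(y,x) \<notin> E" if "C \<in> \<D>" "x \<in> S C - {a C}" "y \<in> ?T - {a C}" for C x y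
    proof
      assume e: "(y,x) \<in> E"
      have x: "x \<in> C" "x \<in> W" using SC[OF that(1,2)] \<C>W[OF \<D>\<C>[OF that(1)]] by auto
      show False
      proof (cases "y = r")
        case True
        then show False using e x(2) by (auto simp: W_def A_def)
      next
        case False
        then have "y \<in> A'" using that by blast
        \<comment> \<open>Since \<open>C\<close> is hit once, the only selected point adjacent to it
          is \<open>a C\<close>, which was excluded for \<open>y\<close>.\<close>
        then have "y \<in> N (Inr C) \<inter> A'" using e x(1) A'(1) by (auto simp: N_def)
        then show False using aS[OF that(1)] that(3) by auto
      qed
    qed
    show "(S C - {a C}) \<inter> (S D - {a D}) = {}" if "C \<in> \<D>" "D \<in> \<D>" "C \<noteq> D" for C D
      using \<C>disj[OF \<D>\<C>[OF that(1)] \<D>\<C>[OF that(2)] that(3)] SC[OF that(1)] SC[OF that(2)] by blast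
    show "(y,x) \<notin> E" if "C \<in> \<D>" "D \<in> \<D>" "C \<noteq> D" "x \<in> S C - {a C}" "y \<in> S D - {a D}" for C D x y
      using \<C>edge[OF \<D>\<C>[OF that(1)] \<D>\<C>[OF that(2)] that(3)] SC[OF that(1)] SC[OF that(2)] that by blast
  qed (use aS in auto)
  have "?T \<union> (\<Union>C\<in>\<D>. S C) \<subseteq> V"
  proof -
    have "S C \<subseteq> V" if "C \<in> \<D>" for C using aS[OF that] A'(1) \<C>W[OF \<D>\<C>[OF that]] V by blast
    then show ?thesis using V(1) A'(1) by blast
  qed
  moreover have "sqrt (real (card V - 1)) \<le> real (card (?T \<union> (\<Union>C\<in>\<D>. S C)) - 1)"
  proof -
    have "sqrt (real (card V - 1)) \<le> real (card A') + (\<Sum>C\<in>\<D>. sqrt (real (card C)))"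
      using A'(2) total hit by simp
    also have "\<dots> \<le> real (card A') + (\<Sum>C\<in>\<D>. real (card (S C) - 1))"
      using aS by (intro add_left_mono sum_mono) blast
    also have "\<dots> = real (card (?T \<union> (\<Union>C\<in>\<D>. S C)) - 1)"
      using glue finD(2) rA(1) A'(1) by (subst conjunct2[OF glue]) (auto simp: card_insert_if)
    finally show ?thesis .
  qed
  ultimately show ?case using glue by blast
qed

section \<open>Leaf trees are induced trees\<close>

lemma leaf_tree_reachable:
  assumes "leaf_tree E r T" "u \<in> T"
  shows "(r,u) \<in> rtrancl_on T E"
  using assms
proof (induction arbitrary: u rule: leaf_tree.induct)
  case root
  then show ?case by simp
next
  case (leaf T v w)
  have "(r,x) \<in> rtrancl_on (insert v T) E" if "x \<in> T" for x
    using leaf.IH[OF that] by (rule rtrancl_on_mono[rotated 2]) auto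
  then show ?case using leaf.hyps leaf.prems by (auto intro: rtrancl_on_into_rtrancl_on)
qed

text \<open>The vertex attached last has a single neighbour in the tree, so it cannot lie in
  \<open>W\<close>, where every vertex has two distinct ones. Peeling off leaves in reverse order
  empties \<open>W\<close>.\<close>

lemma leaf_tree_no_core:
  assumes "leaf_tree E r T" "sym E" "\<And>x. (x,x) \<notin> E" "W \<subseteq> T"
    "\<And>x. x \<in> W \<Longrightarrow> \<exists>y\<in>W. \<exists>z\<in>W. y \<noteq> z \<and> (x,y) \<in> E \<and> (z,x) \<in> E"
  shows "W = {}"
  using assms
proof (induction rule: leaf_tree.induct)
  case root
  then show ?case by blast
next
  case (leaf T u w)
  have "u \<notin> W"
  proof
    assume "u \<in> W"
    then obtain y z where yz: "y \<in> W" "z \<in> W" "y \<noteq> z" "(u,y) \<in> E" "(z,u) \<in> E"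
      using leaf.prems by blast
    then have "(y,u) \<in> E" "y \<in> T" "z \<in> T" using leaf.prems by (auto dest: symD)
    then show False using leaf.hyps yz by blast
  qed
  then show ?case using leaf by blast
qed

text \<open>\<open>W\<close> consists of the vertices of the cycle: each is joined to its
  predecessor and its successor, which differ since the vertices are distinct and at least three in
  number.\<close>

lemma cycle_two_neighbours:
  assumes "pre_digraph.cycle (with_proj G \<restriction> S) p" "3 \<le> length p"
  obtains W where "W \<subseteq> S" "W \<noteq> {}"
    "\<And>x. x \<in> W \<Longrightarrow> \<exists>y\<in>W. \<exists>z\<in>W. y \<noteq> z \<and> (x,y) \<in> parcs G \<and> (z,x) \<in> parcs G"
proof -
  let ?H = "with_proj G \<restriction> S"
  let ?n = "length p"
  from assms(1) obtain u where u: "set p \<subseteq> arcs ?H" "pre_digraph.cas ?H u p u"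
      "distinct (tl (pre_digraph.awalk_verts ?H u p))" "p \<noteq> []"
    unfolding pre_digraph.cycle_def pre_digraph.awalk_def by blast
  have dist: "distinct (map snd p)"
    using u(3,4) unfolding pre_digraph.awalk_verts_conv'[OF u(2)] by simp
  have cas: "fst (p ! 0) = a \<and> snd (p ! (length p - 1)) = b \<and>
      (\<forall>i. Suc i < length p \<longrightarrow> fst (p ! Suc i) = snd (p ! i))"
    if "pre_digraph.cas ?H a p b" "p \<noteq> []" for a b p
    using that
  proof (induction p arbitrary: a)
    case Nil
    then show ?case by simp
  next
    case (Cons e q)
    show ?case
    proof (cases "q = []")
      case True
      then show ?thesis using Cons.prems by (simp add: pre_digraph.cas.simps)
    next
      case False
      have "fst (q ! 0) = snd e \<and> snd (q ! (length q - 1)) = b \<and>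
          (\<forall>i. Suc i < length q \<longrightarrow> fst (q ! Suc i) = snd (q ! i))"
        using Cons.prems False by (intro Cons.IH) (auto simp: pre_digraph.cas.simps)
      then show ?thesis using Cons.prems False
        by (auto simp: pre_digraph.cas.simps nth_Cons split: nat.split)
    qed
  qed
  have next_arc: "fst (p ! (Suc i mod ?n)) = snd (p ! i)" if "i < ?n" for i
  proof (cases "Suc i < ?n")
    case True
    then show ?thesis using cas[OF u(2,4)] by simp
  next
    case False
    then have "Suc i = ?n" "i = ?n - 1" using that by auto
    then show ?thesis using cas[OF u(2,4)] by simp
  qed
  show thesis
  proof
    show "snd ` set p \<subseteq> S" using u(1) by auto
    show "snd ` set p \<noteq> {}" using u(4) by simp
    show "\<exists>y\<in>snd ` set p. \<exists>z\<in>snd ` set p. y \<noteq> z \<and> (x,y) \<in> parcs G \<and> (z,x) \<in> parcs G"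
      if "x \<in> snd ` set p" for x
    proof -
      obtain i where i: "i < ?n" "x = snd (p ! i)" using \<open>x \<in> snd ` set p\<close> by (auto simp: in_set_conv_nth)
      \<comment> \<open>The arc \<open>p ! i\<close> ends in \<open>x\<close>; \<open>j\<close> and
        \<open>k\<close> are the cyclically next and previous positions. They differ because the
        cycle has at least 3 arcs.\<close>
      define j where "j = Suc i mod ?n"
      define k where "k = (if i = 0 then ?n - 1 else i - 1)"
      have jk: "j < ?n" "k < ?n" "j \<noteq> k" "Suc k mod ?n = i"
        using i(1) assms(2) by (auto simp: j_def k_def mod_Suc)
      have "snd (p ! j) \<noteq> snd (p ! k)"
        using jk dist by (metis length_map nth_eq_iff_index_eq nth_map)
      moreover have "p ! i = (snd (p ! k), x)" using next_arc[OF jk(2)] jk(4) i by (simp add: prod_eq_iff)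
      moreover have "p ! j = (x, snd (p ! j))" using next_arc[OF i(1)] i by (simp add: prod_eq_iff j_def)
      moreover have "p ! i \<in> parcs G" "p ! j \<in> parcs G" using u(1) i jk nth_mem by fastforce+
      ultimately show ?thesis using jk(1,2) nth_mem
        by (intro bexI[of _ "snd (p ! j)"] bexI[of _ "snd (p ! k)"]) auto
    qed
  qed
qed

text \<open>Any two vertices are connected through the root, and the vertices of a cycle would form
  a nonempty set excluded by \<open>leaf_tree_no_core\<close>.\<close>

lemma leaf_tree_undirected_tree:
  assumes "pair_graph G" "leaf_tree (parcs G) r S"
  shows "undirected_tree (with_proj G \<restriction> S)"
proof -
  interpret pair_graph G by fact
  have sym: "sym (parcs G)" using sym_arcs by (simp add: symmetric_def)
  have r: "(r,u) \<in> rtrancl_on S (parcs G)" if "u \<in> S" for u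
    using leaf_tree_reachable[OF assms(2) that] .
  then have r': "(u,r) \<in> rtrancl_on S (parcs G)" if "u \<in> S" for u
    using that rtrancl_on_sym[OF sym, of S] by (auto dest: symD)
  have "(u,v) \<in> rtrancl_on S (parcs (mk_symmetric (with_proj G \<restriction> S)))" if "u \<in> S" "v \<in> S" for u v
  proof -
    have "(u,v) \<in> rtrancl_on S (parcs G)" using r' r that rtrancl_on_trans by metis
    then show ?thesis
    proof (induction rule: rtrancl_on_induct)
      case base
      then show ?case using that by simp
    next
      case (step y z)
      then have "(y,z) \<in> parcs (mk_symmetric (with_proj G \<restriction> S))"
        by (force simp: mk_symmetric_def)
      then show ?case using step by (blast intro: rtrancl_on_into_rtrancl_on)
    qed
  qed
  then have "Digraph_Component.connected (with_proj G \<restriction> S)"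
    using leaf_tree_root[OF assms(2)]
    by (auto simp: Digraph_Component.connected_def strongly_connected_def reachable_def)
  moreover have "undirected_forest (with_proj G \<restriction> S)"
    unfolding undirected_forest_def
  proof
    assume "\<exists>p. pre_digraph.cycle (with_proj G \<restriction> S) p \<and> 3 \<le> length p"
    then obtain p where "pre_digraph.cycle (with_proj G \<restriction> S) p" "3 \<le> length p" by blast
    then obtain W where "W \<subseteq> S" "W \<noteq> {}"
      "\<And>x. x \<in> W \<Longrightarrow> \<exists>y\<in>W. \<exists>z\<in>W. y \<noteq> z \<and> (x,y) \<in> parcs G \<and> (z,x) \<in> parcs G"
      using cycle_two_neighbours by blast
    moreover have "(x,x) \<notin> parcs G" for x using no_loops[of "(x,x)"] by auto
    ultimately show False using leaf_tree_no_core[OF assms(2) sym] by blast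
  qed
  ultimately show ?thesis by (simp add: undirected_tree_def)
qed

section \<open>The lower bound \<surd>n for \<open>f_T\<close> and \<open>f_B\<close>\<close>

lemma sqrt_le_max_induced_tree:
  assumes "pair_graph G" "Digraph_Component.connected (with_proj G)" "triangle_free (with_proj G)"
  shows "sqrt (real (card (pverts G))) \<le> real (max_induced_tree (with_proj G))"
proof -
  interpret pair_graph G by fact
  have sym: "sym (parcs G)" using sym_arcs by (simp add: symmetric_def)
  have fin: "finite (pverts G)" by (rule pair_finite_verts)
  have "parcs (mk_symmetric (with_proj G)) = parcs G"
    using sym by (auto simp: mk_symmetric_def dest: symD)
  then have conn: "pverts G \<noteq> {}"
      "\<And>u v. u \<in> pverts G \<Longrightarrow> v \<in> pverts G \<Longrightarrow> (u,v) \<in> rtrancl_on (pverts G) (parcs G)"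
    using assms(2) by (auto simp: Digraph_Component.connected_def strongly_connected_def reachable_def)
  from conn(1) obtain r where r: "r \<in> pverts G" by blast
  have ends: "arcs_ends (with_proj G) = parcs G" by simp
  have "(z,x) \<notin> parcs G" if "(x,y) \<in> parcs G" "(y,z) \<in> parcs G" for x y z
    using assms(3) that unfolding triangle_free_def ends by blast
  then obtain S where S: "S \<subseteq> pverts G" "leaf_tree (parcs G) r S"
      "sqrt (real (card (pverts G) - 1)) \<le> real (card S - 1)"
    using exists_large_leaf_tree[OF fin sym _ r conn(2)[OF r]] by blast
  have "card S \<in> {card S | S. S \<subseteq> verts (with_proj G) \<and> undirected_tree (with_proj G \<restriction> S)}"
    using S leaf_tree_undirected_tree[OF assms(1)] by auto
  then have max: "card S \<le> max_induced_tree (with_proj G)"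
    unfolding max_induced_tree_def using finite_induced_trees[OF assms(1) conn(1)] by (rule Max_ge[rotated])
  have pos: "card S > 0" "card (pverts G) > 0"
    using leaf_tree_root[OF S(2)] leaf_tree_finite[OF S(2)] r fin by (auto simp: card_gt_0_iff)
  \<comment> \<open>The root, discounted in the bound for \<open>S\<close>, makes up for the vertex
    missing under the square root.\<close>
  have "sqrt (real (card (pverts G))) \<le> sqrt (real (card (pverts G) - 1)) + sqrt 1"
    using pos sqrt_add_le_add_sqrt[of "real (card (pverts G) - 1)" 1] by (simp add: of_nat_diff)
  also have "\<dots> \<le> real (card S)" using S(3) pos by (simp add: of_nat_diff)
  finally show ?thesis using max by simp
qed

lemma bipartite_triangle_free: "bipartite G \<Longrightarrow> triangle_free G"
  unfolding bipartite_def triangle_free_def by blast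

lemma sqrt_le_f_T:
  assumes "n > 0"
  shows "sqrt (real n) \<le> real (f_T n)"
proof -
  have "f_T n \<in> {max_induced_tree (with_proj G) | G :: nat pair_pre_digraph.
     pair_graph G \<and> card (pverts G) = n \<and>
     Digraph_Component.connected (with_proj G) \<and> triangle_free (with_proj G)}"
    unfolding f_T_def
    using finite_graph_family[OF assms] graph_family_nonempty[OF assms, where P = triangle_free, OF star_graph(5)[OF assms]]
    by (rule Min_in)
  then show ?thesis using sqrt_le_max_induced_tree by auto
qed

lemma sqrt_le_f_B:
  assumes "n > 0"
  shows "sqrt (real n) \<le> real (f_B n)"
proof -
  have "f_B n \<in> {max_induced_tree (with_proj G) | G :: nat pair_pre_digraph.
     pair_graph G \<and> card (pverts G) = n \<and>
     Digraph_Component.connected (with_proj G) \<and> bipartite (with_proj G)}"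
    unfolding f_B_def
    using finite_graph_family[OF assms] graph_family_nonempty[OF assms, where P = bipartite, OF star_graph(4)[OF assms]]
    by (rule Min_in)
  then show ?thesis using sqrt_le_max_induced_tree[OF _ _ bipartite_triangle_free] by auto
qed

theorem corollary2p3:
  shows "((\<exists>n0::nat. n0 > 0 \<and> real (f_T n0) < sqrt (real n0)) \<longrightarrow>
            (\<exists>\<epsilon>::real. \<epsilon> > 0 \<and> (\<lambda>n::nat. real (f_T n)) \<in> O(\<lambda>n. real n powr (1/2 - \<epsilon>))))
       \<and> ((\<exists>n0::nat. n0 > 0 \<and> real (f_B n0) < sqrt (real n0)) \<longrightarrow>
            (\<exists>\<epsilon>::real. \<epsilon> > 0 \<and> (\<lambda>n::nat. real (f_B n)) \<in> O(\<lambda>n. real n powr (1/2 - \<epsilon>))))"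
  \<comment> \<open>Each premise contradicts the corresponding lower bound.\<close>
  using sqrt_le_f_T sqrt_le_f_B by (meson not_le)

end
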